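(* Let $G$ be a mixed graph on $n$ vertices, with $\mathcal{I}$-eigenvalues $\boldsymbol{\lambda}_1(G)\ge\cdots\ge\boldsymbol{\lambda}_{2n}(G)$. Then $$\boldsymbol{\lambda}_{2n-1}(G)\le\frac1n\left[2e(G)+2l(G)+a(G)\right]\le\boldsymbol{\lambda}_1(G)$$ and $$\boldsymbol{\lambda}_{2n}(G)\le\frac1n\left[2e(G)+2l(G)-a(G)\right]\le\boldsymbol{\lambda}_2(G),$$ where $e(G)$ is the number of edges of $G$ excluding loops, $l(G)$ is the number of loops, and $a(G)$ is the number of arcs including directed loops.
   Context: A mixed graph $G$ has a finite nonempty vertex set $V_G=\{v_1,\dots,v_n\}$, a finite set $E_G$ of (undirected) edges, each joining an unordered pair of vertices $\{u,v\}$ (a loop if $u=v$), and a finite set $\vec E_G$ of arcs, each going from $u$ to $v$ for an ordered pair $(u,v)$ of vertices (a directed loop if $u=v$); multiple edges, loops, arcs and directed loops are allowed. The integrated adjacency matrix $\mathcal{I}(G)$ is the real symmetric $2n\times 2n$ matrix $\begin{bmatrix}A&D\\ D^T&A\end{bmatrix}$, where $A_{ij}$ ($i\neq j$) is the number of edges joining $v_i$ and $v_j$, $A_{ii}$ is twice the number of loops at $v_i$, and $D_{ij}$ is the number of arcs from $v_i$ to $v_j$. Its eigenvalues, counted with multiplicity, are the $\mathcal{I}$-eigenvalues of $G$. *)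

theory Defs
  imports
    "HOL-Library.Uprod"
    "Jordan_Normal_Form.Char_Poly"
begin

text \<open>
  Edges and arcs are abstract objects with an incidence map, so parallel edges and parallel arcs
  are allowed. An edge \<open>e\<close> is a loop at \<open>u\<close> iff \<open>ends G e = Upair u u\<close>, and an arc \<open>a\<close> is a
  directed loop at \<open>u\<close> iff \<open>tail G a = head G a = u\<close>.
\<close>

record ('v, 'e, 'a) mixed_graph =
  verts :: "'v set"
  edges :: "'e set"
  arcs :: "'a set"
  ends :: "'e \<Rightarrow> 'v uprod"
  tail :: "'a \<Rightarrow> 'v"
  head :: "'a \<Rightarrow> 'v"

locale mixed_graph =
  fixes G :: "('v, 'e, 'a) mixed_graph"
  assumes finite_verts: "finite (verts G)"
    and verts_nonempty: "verts G \<noteq> {}"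
    and finite_edges: "finite (edges G)"
    and finite_arcs: "finite (arcs G)"
    and ends_in_verts: "e \<in> edges G \<Longrightarrow> set_uprod (ends G e) \<subseteq> verts G"
    and tail_in_verts: "a \<in> arcs G \<Longrightarrow> tail G a \<in> verts G"
    and head_in_verts: "a \<in> arcs G \<Longrightarrow> head G a \<in> verts G"

definition num_edges :: "('v, 'e, 'a) mixed_graph \<Rightarrow> nat" where
  "num_edges G = card {e \<in> edges G. proper_uprod (ends G e)}"

definition num_loops :: "('v, 'e, 'a) mixed_graph \<Rightarrow> nat" where
  "num_loops G = card {e \<in> edges G. \<not> proper_uprod (ends G e)}"

definition num_arcs :: "('v, 'e, 'a) mixed_graph \<Rightarrow> nat" where
  "num_arcs G = card (arcs G)"

text \<open>
  The matrices refer to an enumeration \<open>v 0, \<dots>, v (n - 1)\<close> of the \<open>n\<close> vertices, that is, a function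
  \<open>v\<close> with \<open>bij_betw v {..<n} (verts G)\<close>.
\<close>

definition edge_mat :: "('v, 'e, 'a) mixed_graph \<Rightarrow> (nat \<Rightarrow> 'v) \<Rightarrow> real mat" where
  "edge_mat G v = mat (card (verts G)) (card (verts G)) (\<lambda>(i, j).
     if i = j then 2 * real (card {e \<in> edges G. ends G e = Upair (v i) (v i)})
     else real (card {e \<in> edges G. ends G e = Upair (v i) (v j)}))"

definition arc_mat :: "('v, 'e, 'a) mixed_graph \<Rightarrow> (nat \<Rightarrow> 'v) \<Rightarrow> real mat" where
  "arc_mat G v = mat (card (verts G)) (card (verts G)) (\<lambda>(i, j).
     real (card {a \<in> arcs G. tail G a = v i \<and> head G a = v j}))"

definition integrated_adjacency_mat ::
    "('v, 'e, 'a) mixed_graph \<Rightarrow> (nat \<Rightarrow> 'v) \<Rightarrow> real mat" where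
  "integrated_adjacency_mat G v =
     four_block_mat (edge_mat G v) (arc_mat G v)
                    (transpose_mat (arc_mat G v)) (edge_mat G v)"

text \<open>
  The real eigenvalues of \<open>M\<close> in decreasing order, each repeated according to its multiplicity as
  a root of the characteristic polynomial. For a real symmetric matrix of dimension \<open>m\<close> that
  polynomial splits over the reals, so the list has length \<open>m\<close>.
\<close>

definition eigenvalue_list :: "real mat \<Rightarrow> real list" where
  "eigenvalue_list M = rev (sorted_list_of_multiset (proots (char_poly M)))"

text \<open>The index \<open>k\<close> starts at 1, so \<open>I_eigenvalue G v 1\<close> is the largest eigenvalue.\<close>

definition I_eigenvalue :: "('v, 'e, 'a) mixed_graph \<Rightarrow> (nat \<Rightarrow> 'v) \<Rightarrow> nat \<Rightarrow> real" where
  "I_eigenvalue G v k = eigenvalue_list (integrated_adjacency_mat G v) ! (k - 1)"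

end

theory Submission
  imports Defs
begin

text \<open>
  Let \<open>M\<close> be the integrated adjacency matrix, and consider the plane of vectors that take a constant
  value \<open>p\<close> on the first \<open>n\<close> coordinates and a constant value \<open>q\<close> on the last \<open>n\<close>. Write \<open>s\<close> for the
  sum of the entries of the edge block and \<open>a\<close> for that of the arc block. On such a vector \<open>x\<close>,

    \<open>x \<bullet> x = n (p\<^sup>2 + q\<^sup>2)\<close> and \<open>x \<bullet> M x = s (p\<^sup>2 + q\<^sup>2) + 2 a p q\<close>,

  so the Rayleigh quotient of \<open>M\<close> on the plane ranges exactly between \<open>(s - a) / n\<close>, attained at
  \<open>q = - p\<close>, and \<open>(s + a) / n\<close>, attained at \<open>q = p\<close>. Counting each edge and each arc by its entries
  gives \<open>s = 2 e(G) + 2 l(G)\<close> and \<open>a = a(G)\<close>, hence these two numbers are the ones in the theorem.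

  The four inequalities are then instances of the min-max principle. The extreme eigenvalues bound
  every Rayleigh quotient (\<open>rayleigh_quotient_bounds\<close>), so the value at \<open>q = p\<close> is at most the largest
  eigenvalue and the value at \<open>q = - p\<close> is at least the smallest. A plane contains a nonzero vector
  orthogonal to any one prescribed eigenvector. Choosing an eigenvector for the largest eigenvalue
  shows that the second largest one is at least the minimum of the Rayleigh quotient on the plane;
  choosing one for the smallest eigenvalue gives the dual bound (\<open>eigenvalue_plane_bounds\<close>).

  The min-max principle needs an orthonormal eigenbasis whose eigenvalues are the roots of the
  characteristic polynomial with multiplicity. It comes from the spectral theorem for real symmetric
  matrices, which is proved by splitting off one eigenvector at a time with a Householder reflection.
\<close>

section \<open>The spectral theorem for real symmetric matrices\<close>

text \<open>
  Over the complex numbers an eigenpair \<open>C z = c z\<close> exists. The sesquilinear form \<open>conjugate z \<bullet> C z\<close>,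
  evaluated with \<open>C\<close> acting on either side, is both \<open>c\<close> and \<open>cnj c\<close> times the nonzero number
  \<open>conjugate z \<bullet> z\<close>, so \<open>c\<close> is a real root of the characteristic polynomial.
\<close>

lemma real_symmetric_eigenvalue_exists:
  fixes A :: "real mat"
  assumes A: "A \<in> carrier_mat n n" and sym: "transpose_mat A = A" and n: "n \<noteq> 0"
  shows "\<exists>e. eigenvalue A e"
proof -
  let ?C = "map_mat complex_of_real A"
  have C: "?C \<in> carrier_mat n n" using A by auto
  obtain as where as: "char_poly ?C = (\<Prod>a\<leftarrow>as. [:- a, 1:])" and len: "length as = n"
    using char_poly_factorized[OF C] by blast
  from len n obtain c where "c \<in> set as" by (cases as) auto
  then have root: "poly (char_poly ?C) c = 0"
    unfolding as by (auto simp: poly_prod_list prod_list_zero_iff)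
  then have "eigenvalue ?C c" using eigenvalue_root_char_poly[OF C] by simp
  then obtain z where z: "z \<in> carrier_vec n" and z0: "z \<noteq> 0\<^sub>v n" and ev: "?C *\<^sub>v z = c \<cdot>\<^sub>v z"
    using C unfolding eigenvalue_def eigenvector_def by auto
  have cz: "conjugate z \<in> carrier_vec n" using z by auto
  have symC: "transpose_mat ?C = ?C"
    using arg_cong[OF sym, of "map_mat complex_of_real"] by (simp add: map_mat_transpose)
  have "?C *\<^sub>v conjugate z = conjugate (?C *\<^sub>v z)"
    using A z by (intro eq_vecI) (auto simp: scalar_prod_def intro!: sum.cong)
  also have "\<dots> = cnj c \<cdot>\<^sub>v conjugate z"
    unfolding ev using z by (intro eq_vecI) auto
  finally have ev': "?C *\<^sub>v conjugate z = cnj c \<cdot>\<^sub>v conjugate z" .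
  have "cnj c * (conjugate z \<bullet> z) = (transpose_mat ?C *\<^sub>v conjugate z) \<bullet> z"
    unfolding symC ev' using z cz by simp
  also have "\<dots> = conjugate z \<bullet> (?C *\<^sub>v z)"
    by (rule transpose_vec_mult_scalar[OF C z cz])
  also have "\<dots> = c * (conjugate z \<bullet> z)"
    unfolding ev using z cz by simp
  finally have "cnj c * (conjugate z \<bullet> z) = c * (conjugate z \<bullet> z)" .
  moreover have "conjugate z \<bullet> z \<noteq> 0"
    using conjugate_square_eq_0_vec[OF z] z0 comm_scalar_prod[OF cz z] by auto
  ultimately have "cnj c = c" by simp
  then obtain e where e: "c = complex_of_real e"
    by (metis complex_cnj_cancel_iff Reals_cnj_iff Reals_cases)
  have "complex_of_real (poly (char_poly A) e) = poly (char_poly ?C) c"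
    unfolding e of_real_hom.char_poly_hom[OF A] by simp
  then have "poly (char_poly A) e = 0" using root by simp
  then show ?thesis using eigenvalue_root_char_poly[OF A] by blast
qed

text \<open>
  The Householder reflection in the hyperplane orthogonal to \<open>w = v - e\<^sub>0\<close> exchanges the unit vectors
  \<open>e\<^sub>0\<close> and \<open>v\<close>. A reflection is symmetric and its own inverse, which makes it the most convenient
  orthogonal matrix with \<open>v\<close> as its first column.
\<close>

lemma orthogonal_completion:
  fixes v :: "real vec"
  assumes v: "v \<in> carrier_vec n" and unit: "v \<bullet> v = 1" and n: "n \<noteq> 0"
  obtains H where "H \<in> carrier_mat n n" "transpose_mat H = H" "H * H = 1\<^sub>m n"
    "H *\<^sub>v unit_vec n 0 = v"
proof -
  define w where "w i = v $ i - (if i = 0 then 1 else 0)" for i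
  define s where "s = (\<Sum>k\<in>{0..<n}. w k * w k)"
  \<comment> \<open>If \<open>v = e\<^sub>0\<close> then \<open>s = 0\<close>, and division by zero yields the identity matrix, as desired.\<close>
  define H where "H = mat n n (\<lambda>(i, j). (if i = j then 1 else 0) - 2 * (w i * w j) / s)"
  have H: "H \<in> carrier_mat n n" unfolding H_def by auto
  have HT: "transpose_mat H = H" unfolding H_def by (intro eq_matI) auto
  have HH: "H * H = 1\<^sub>m n"
  proof (rule eq_matI)
    fix i j assume "i < dim_row (1\<^sub>m n :: real mat)" "j < dim_col (1\<^sub>m n :: real mat)"
    then have i: "i < n" and j: "j < n" by auto
    let ?d = "\<lambda>i j. if i = j then 1 else 0 :: real"
    have "(H * H) $$ (i, j) =
        (\<Sum>k\<in>{0..<n}. (?d i k - 2 * (w i * w k) / s) * (?d k j - 2 * (w k * w j) / s))"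
      using i j by (auto simp: H_def scalar_prod_def intro!: sum.cong)
    also have "\<dots> = (\<Sum>k\<in>{0..<n}. (if k = i then ?d i j - 2 * (w i * w j) / s else 0)
        - (if k = j then 2 * (w i * w j) / s else 0)
        + 4 * (w i * w j) / (s * s) * (w k * w k))"
      by (intro sum.cong) (auto simp: algebra_simps)
    also have "\<dots> = ?d i j - 2 * (w i * w j) / s - 2 * (w i * w j) / s
        + 4 * (w i * w j) / (s * s) * s"
      unfolding sum.distrib sum_subtractf sum_distrib_left[symmetric] s_def[symmetric]
      using i j by simp
    also have "\<dots> = ?d i j" by simp
    finally show "(H * H) $$ (i, j) = 1\<^sub>m n $$ (i, j)" using i j by simp
  qed (use H in auto)
  \<comment> \<open>Since \<open>v\<close> is a unit vector, \<open>s = 2 - 2 v\<^sub>0 = - 2 w\<^sub>0\<close>, so the first column of \<open>H\<close> is \<open>e\<^sub>0 + w = v\<close>.\<close>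
  have sum0: "(\<Sum>k\<in>{0..<n}. f k) = f 0 + (\<Sum>k\<in>{0..<n} - {0}. f k)" for f :: "nat \<Rightarrow> real"
    using n by (intro sum.remove) auto
  have "s = (v $ 0 - 1) * (v $ 0 - 1) + (\<Sum>k\<in>{0..<n} - {0}. v $ k * v $ k)"
    unfolding s_def sum0 by (auto simp: w_def intro!: sum.cong)
  moreover have "1 = v $ 0 * v $ 0 + (\<Sum>k\<in>{0..<n} - {0}. v $ k * v $ k)"
    using unit v sum0[of "\<lambda>k. v $ k * v $ k"] by (simp add: scalar_prod_def)
  ultimately have s: "s = - 2 * w 0"
    by (simp add: w_def algebra_simps)
  have "w i = 0" if "s = 0" "i < n" for i
  proof -
    have "\<forall>k\<in>{0..<n}. w k * w k = 0"
      using that(1) unfolding s_def by (subst (asm) sum_nonneg_eq_0_iff) auto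
    then show ?thesis using that(2) by auto
  qed
  then have wi: "- 2 * (w i * w 0) / s = w i" if "i < n" for i
    using that s by (cases "s = 0") auto
  have Hv: "H *\<^sub>v unit_vec n 0 = v"
  proof (rule eq_vecI)
    fix i assume "i < dim_vec v"
    then have i: "i < n" using v by simp
    have "(H *\<^sub>v unit_vec n 0) $ i = H $$ (i, 0)"
      using i n H by simp
    also have "\<dots> = (if i = 0 then 1 else 0) + - 2 * (w i * w 0) / s"
      using i n by (simp add: H_def)
    also have "\<dots> = v $ i" unfolding wi[OF i] by (simp add: w_def)
    finally show "(H *\<^sub>v unit_vec n 0) $ i = v $ i" .
  qed (use H v in auto)
  show thesis using that[OF H HT HH Hv] .
qed

text \<open>
  Conjugating by a reflection that sends \<open>e\<^sub>0\<close> to a unit eigenvector makes the first column of the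
  matrix equal to \<open>e \<cdot> e\<^sub>0\<close>. Symmetry is preserved, so the first row has the same shape and the matrix is
  block diagonal with a smaller symmetric block, to which the induction hypothesis applies. Taking
  the inverse of the transition matrix to be its transpose expresses orthogonality.
\<close>

theorem real_spectral_theorem:
  fixes A :: "real mat"
  assumes "A \<in> carrier_mat n n" and "transpose_mat A = A"
  shows "\<exists>f P. similar_mat_wit A (mat_diag n f) P (transpose_mat P)"
  using assms
proof (induction n arbitrary: A)
  case 0
  then show ?case
    by (intro exI[of _ "\<lambda>_. 0"] exI[of _ "1\<^sub>m 0"] similar_mat_witI[of _ _ 0]) auto
next
  case (Suc m A)
  note A = Suc.prems(1) and sym = Suc.prems(2)
  let ?n = "Suc m"
  obtain e where "eigenvalue A e"
    using real_symmetric_eigenvalue_exists[OF A sym] by auto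
  then obtain u where u: "u \<in> carrier_vec ?n" and u0: "u \<noteq> 0\<^sub>v ?n" and Au: "A *\<^sub>v u = e \<cdot>\<^sub>v u"
    using A unfolding eigenvalue_def eigenvector_def by auto
  define v where "v = (1 / sqrt (u \<bullet> u)) \<cdot>\<^sub>v u"
  have "u \<bullet> u > 0" using conjugate_square_greater_0_vec[OF u] u0 u
    by (simp add: scalar_prod_def)
  then have unit: "v \<bullet> v = 1" unfolding v_def using u by (simp add: real_sqrt_mult[symmetric])
  have v: "v \<in> carrier_vec ?n" unfolding v_def using u by simp
  have Av: "A *\<^sub>v v = e \<cdot>\<^sub>v v"
    unfolding v_def using A u by (simp add: mult_mat_vec Au smult_smult_assoc mult.commute)
  obtain H where H: "H \<in> carrier_mat ?n ?n" and HT: "transpose_mat H = H"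
    and HH: "H * H = 1\<^sub>m ?n" and Hv: "H *\<^sub>v unit_vec ?n 0 = v"
    using orthogonal_completion[OF v unit] by blast
  define B where "B = H * A * H"
  have B: "B \<in> carrier_mat ?n ?n" unfolding B_def using H A by simp
  have AB: "similar_mat_wit A B H (transpose_mat H)"
    unfolding HT
    by (rule similar_mat_wit_sym, rule similar_mat_witI[OF HH HH B_def B A H H])
  have BT: "transpose_mat B = B"
    unfolding B_def using A H
    by (simp add: transpose_mult[of _ ?n ?n _ ?n] HT sym assoc_mult_mat[of _ ?n ?n _ ?n _ ?n])
  have "H *\<^sub>v v = unit_vec ?n 0"
    unfolding Hv[symmetric] using H HH
    by (metis assoc_mult_mat_vec one_mult_mat_vec unit_vec_carrier)
  then have Be: "B *\<^sub>v unit_vec ?n 0 = e \<cdot>\<^sub>v unit_vec ?n 0"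
    unfolding B_def using A H v
    by (simp add: assoc_mult_mat_vec[of _ ?n ?n _ ?n] Hv Av mult_mat_vec)
  have col0: "B $$ (i, 0) = (if i = 0 then e else 0)" if "i < ?n" for i
  proof -
    have "B $$ (i, 0) = (B *\<^sub>v unit_vec ?n 0) $ i" using that B by simp
    then show ?thesis unfolding Be using that by simp
  qed
  have row0: "B $$ (0, j) = (if j = 0 then e else 0)" if "j < ?n" for j
  proof -
    have "B $$ (0, j) = transpose_mat B $$ (j, 0)" using that B by simp
    then show ?thesis unfolding BT col0[OF that] .
  qed
  define D where "D = mat m m (\<lambda>(i, j). B $$ (Suc i, Suc j))"
  have D: "D \<in> carrier_mat m m" unfolding D_def by simp
  have BTij: "B $$ (i, j) = B $$ (j, i)" if "i < ?n" "j < ?n" for i j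
    using that B BT by (metis carrier_matD index_transpose_mat(1))
  have DT: "transpose_mat D = D"
    unfolding D_def by (intro eq_matI) (auto intro: BTij)
  let ?E = "mat 1 1 (\<lambda>_. e)"
  have Bblock: "B = four_block_mat ?E (0\<^sub>m 1 m) (0\<^sub>m m 1) D"
    by (rule eq_matI) (use B in \<open>auto simp: D_def col0 row0\<close>)
  obtain f P where DP: "similar_mat_wit D (mat_diag m f) P (transpose_mat P)"
    using Suc.IH[OF D DT] by blast
  note P = similar_mat_witD2(6)[OF D DP]
  let ?f = "case_nat e f"
  let ?P = "four_block_mat (1\<^sub>m 1) (0\<^sub>m 1 m) (0\<^sub>m m 1) P"
  have diag: "four_block_mat ?E (0\<^sub>m 1 m) (0\<^sub>m m 1) (mat_diag m f) = mat_diag ?n ?f"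
    unfolding mat_diag_def by (intro eq_matI) (auto split: nat.split)
  have PT: "transpose_mat ?P = four_block_mat (1\<^sub>m 1) (0\<^sub>m 1 m) (0\<^sub>m m 1) (transpose_mat P)"
    using P by (subst transpose_four_block_mat) auto
  have "similar_mat_wit B (mat_diag ?n ?f) ?P (transpose_mat ?P)"
    unfolding PT Bblock diag[symmetric]
    by (rule similar_mat_wit_four_block[OF similar_mat_wit_refl DP _ _ _ D]) (use P in auto)
  from similar_mat_wit_trans[OF AB this]
  have "similar_mat_wit A (mat_diag ?n ?f) (H * ?P) (transpose_mat (H * ?P))"
    using H P by (subst transpose_mult) auto
  then show ?case by blast
qed


section \<open>Min-max bounds for the ordered eigenvalues\<close>

lemma proots_linear_factors:
  fixes xs :: "'a :: idom list"
  shows "proots (\<Prod>a\<leftarrow>xs. [:- a, 1:]) = mset xs"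
proof (induction xs)
  case (Cons a xs)
  have "(\<Prod>b\<leftarrow>xs. [:- b, 1:]) \<noteq> 0" by (auto simp: prod_list_zero_iff)
  then show ?case using Cons by (simp add: proots_mult del: mult_pCons_left)
qed simp

text \<open>
  The spectral theorem gives the eigenvalues in an arbitrary order. Permuting the columns of the
  orthogonal transition matrix aligns them with the decreasing order of the eigenvalue list; the rows
  of \<open>Q\<close> are the corresponding orthonormal eigenvectors.
\<close>

lemma eigenvalue_list_diagonalizes:
  fixes M :: "real mat"
  assumes M: "M \<in> carrier_mat N N" and sym: "transpose_mat M = M"
  obtains Q where "Q \<in> carrier_mat N N" "transpose_mat Q * Q = 1\<^sub>m N"
    "M = transpose_mat Q * mat_diag N (\<lambda>i. eigenvalue_list M ! i) * Q"
    "length (eigenvalue_list M) = N"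
proof -
  obtain f P where fP: "similar_mat_wit M (mat_diag N f) P (transpose_mat P)"
    using real_spectral_theorem[OF M sym] by blast
  note P = similar_mat_witD2[OF M fP]
  have "char_poly M = char_poly (mat_diag N f)"
    using fP by (intro char_poly_similar) (auto simp: similar_mat_def)
  also have "\<dots> = (\<Prod>a\<leftarrow>diag_mat (mat_diag N f). [:- a, 1:])"
    by (rule char_poly_upper_triangular[of _ N])
      (auto simp: mat_diag_def upper_triangular_def)
  also have "diag_mat (mat_diag N f) = map f [0..<N]"
    by (auto simp: diag_mat_def mat_diag_def)
  finally have "proots (char_poly M) = mset (map f [0..<N])"
    by (simp only: proots_linear_factors)
  then have mset: "mset (eigenvalue_list M) = mset (map f [0..<N])"
    unfolding eigenvalue_list_def by simp
  obtain p where p: "p permutes {..<N}" and perm: "permute_list p (map f [0..<N]) = eigenvalue_list M"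
    using mset_eq_permutation[OF mset] by auto
  have pN: "p i < N" if "i < N" for i
    using permutes_in_image[OF p, of i] that by simp
  have ev: "eigenvalue_list M ! i = f (p i)" if "i < N" for i
    unfolding perm[symmetric] using that p pN by (simp add: permute_list_nth)
  define Q where "Q = mat N N (\<lambda>(i, j). P $$ (j, p i))"
  have Q: "Q \<in> carrier_mat N N" unfolding Q_def by simp
  have reindex: "(\<Sum>k\<in>{0..<N}. g (p k)) = (\<Sum>k\<in>{0..<N}. g k)" for g :: "nat \<Rightarrow> real"
    using sum.permute[OF p, of g] by (simp add: o_def atLeast0LessThan)
  have "transpose_mat Q * Q = P * transpose_mat P"
  proof (rule eq_matI)
    fix i j assume "i < dim_row (P * transpose_mat P)" "j < dim_col (P * transpose_mat P)"
    then have ij: "i < N" "j < N" using P(6) by auto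
    then show "(transpose_mat Q * Q) $$ (i, j) = (P * transpose_mat P) $$ (i, j)"
      using P(6) reindex[of "\<lambda>k. P $$ (i, k) * P $$ (j, k)"]
      by (simp add: scalar_prod_def Q_def)
  qed (use P(6) Q in auto)
  then have 1: "transpose_mat Q * Q = 1\<^sub>m N" using P(1) by simp
  let ?L = "transpose_mat Q * mat_diag N (\<lambda>i. eigenvalue_list M ! i)"
  have L: "?L \<in> carrier_mat N N" using Q by simp
  have R: "P * mat_diag N f \<in> carrier_mat N N" using P(6) by simp
  have "?L * Q = P * mat_diag N f * transpose_mat P"
  proof (rule eq_matI)
    fix i j assume "i < dim_row (P * mat_diag N f * transpose_mat P)"
      "j < dim_col (P * mat_diag N f * transpose_mat P)"
    then have ij: "i < N" "j < N" using P(6) by auto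
    have "(?L * Q) $$ (i, j) = (\<Sum>k\<in>{0..<N}. P $$ (i, p k) * f (p k) * P $$ (j, p k))"
      using ij by (auto simp: scalar_prod_def mat_diag_mult_right[of _ N] Q_def ev intro!: sum.cong)
    also have "\<dots> = (P * mat_diag N f * transpose_mat P) $$ (i, j)"
      using ij P(6) reindex[of "\<lambda>k. P $$ (i, k) * f k * P $$ (j, k)"]
      by (simp add: scalar_prod_def mat_diag_mult_right[of _ N])
    finally show "(?L * Q) $$ (i, j) = (P * mat_diag N f * transpose_mat P) $$ (i, j)" .
  qed (use P(6) Q in auto)
  then have 2: "M = ?L * Q" using P(3) by simp
  have "length (eigenvalue_list M) = N" using mset_eq_length[OF mset] by simp
  from that[OF Q 1 2 this] show thesis .
qed

lemma eigenvalue_list_decreasing: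
  assumes "i \<le> j" "j < length (eigenvalue_list M)"
  shows "eigenvalue_list M ! j \<le> eigenvalue_list M ! i"
  using assms unfolding eigenvalue_list_def
  by (simp add: rev_nth) (rule sorted_nth_mono, auto)

text \<open>
  In the coordinates \<open>Q x\<close> of an orthonormal eigenbasis, both the norm and the quadratic form of \<open>M\<close>
  are weighted sums of squares. This reduces all Rayleigh quotient estimates to comparing weights.
\<close>

lemma orthogonal_coordinates:
  fixes M Q :: "real mat"
  assumes Q: "Q \<in> carrier_mat N N" and QQ: "transpose_mat Q * Q = 1\<^sub>m N"
    and MQ: "M = transpose_mat Q * mat_diag N d * Q" and x: "x \<in> carrier_vec N"
  shows "x \<bullet> x = (\<Sum>i<N. ((Q *\<^sub>v x) $ i)\<^sup>2)"
    and "x \<bullet> (M *\<^sub>v x) = (\<Sum>i<N. d i * ((Q *\<^sub>v x) $ i)\<^sup>2)"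
proof -
  let ?y = "Q *\<^sub>v x"
  have y: "?y \<in> carrier_vec N" using Q x by simp
  have QT: "transpose_mat Q \<in> carrier_mat N N" using Q by simp
  have move: "x \<bullet> (transpose_mat Q *\<^sub>v z) = ?y \<bullet> z" if "z \<in> carrier_vec N" for z
    using transpose_vec_mult_scalar[OF QT that x] by simp
  have "x = transpose_mat Q *\<^sub>v ?y"
    using assoc_mult_mat_vec[OF QT Q x] QQ x by simp
  then have "x \<bullet> x = ?y \<bullet> ?y" using move[OF y] by simp
  then show "x \<bullet> x = (\<Sum>i<N. (?y $ i)\<^sup>2)"
    using y Q by (simp add: scalar_prod_def power2_eq_square atLeast0LessThan)
  let ?D = "mat_diag N d"
  have "M *\<^sub>v x = transpose_mat Q *\<^sub>v (?D *\<^sub>v ?y)"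
    unfolding MQ using QT Q x by (simp add: assoc_mult_mat_vec[of _ N N _ N])
  then have "x \<bullet> (M *\<^sub>v x) = ?y \<bullet> (?D *\<^sub>v ?y)"
    using move[of "?D *\<^sub>v ?y"] y by (simp add: mult_mat_vec_carrier[OF mat_diag_dim])
  also have "\<dots> = (\<Sum>i<N. d i * (?y $ i)\<^sup>2)"
  proof -
    have "(?D *\<^sub>v ?y) $ i = d i * ?y $ i" if i: "i < N" for i
    proof -
      have "(?D *\<^sub>v ?y) $ i = (\<Sum>k\<in>{0..<N}. (if i = k then d k else 0) * ?y $ k)"
        using i y Q by (simp add: mat_diag_def scalar_prod_def)
      also have "\<dots> = (\<Sum>k\<in>{0..<N}. if k = i then d i * ?y $ i else 0)"
        by (intro sum.cong) auto
      finally show ?thesis using i by simp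
    qed
    moreover have "dim_vec (?D *\<^sub>v ?y) = N" by (simp add: mat_diag_def)
    ultimately show ?thesis
      by (simp add: scalar_prod_def power2_eq_square atLeast0LessThan mult_ac)
  qed
  finally show "x \<bullet> (M *\<^sub>v x) = (\<Sum>i<N. d i * (?y $ i)\<^sup>2)" .
qed

lemma weighted_sum_le:
  fixes d y :: "nat \<Rightarrow> real"
  assumes "\<And>i. i < N \<Longrightarrow> i \<noteq> k \<Longrightarrow> d i \<le> L" and "y k = 0 \<or> d k \<le> L"
  shows "(\<Sum>i<N. d i * (y i)\<^sup>2) \<le> L * (\<Sum>i<N. (y i)\<^sup>2)"
  unfolding sum_distrib_left
proof (rule sum_mono)
  fix i assume "i \<in> {..<N}"
  then have "y i = 0 \<or> d i \<le> L" using assms by (cases "i = k") auto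
  then show "d i * (y i)\<^sup>2 \<le> L * (y i)\<^sup>2" by (auto intro: mult_right_mono)
qed

text \<open>
  The vanishing of the coordinate \<open>k\<close> is a single linear equation, so it has a nonzero solution in any
  plane. For that vector the weight \<open>d k\<close> does not enter, and the remaining weights bound the Rayleigh
  quotient from both sides.
\<close>

lemma rayleigh_quotient_plane:
  fixes Q :: "real mat"
  assumes Q: "Q \<in> carrier_mat N N" and QQ: "transpose_mat Q * Q = 1\<^sub>m N"
    and M: "M = transpose_mat Q * mat_diag N d * Q"
    and u: "u \<in> carrier_vec N" and w: "w \<in> carrier_vec N"
    and indep: "\<And>p q. p \<cdot>\<^sub>v u + q \<cdot>\<^sub>v w = 0\<^sub>v N \<Longrightarrow> p = 0 \<and> q = 0"
    and k: "k < N"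
  obtains p q x where "x = p \<cdot>\<^sub>v u + q \<cdot>\<^sub>v w" "x \<bullet> x > 0"
    "\<And>L. (\<And>i. i < N \<Longrightarrow> i \<noteq> k \<Longrightarrow> d i \<le> L) \<Longrightarrow> x \<bullet> (M *\<^sub>v x) \<le> L * (x \<bullet> x)"
    "\<And>L. (\<And>i. i < N \<Longrightarrow> i \<noteq> k \<Longrightarrow> L \<le> d i) \<Longrightarrow> L * (x \<bullet> x) \<le> x \<bullet> (M *\<^sub>v x)"
proof -
  obtain p q where pq: "(p, q) \<noteq> (0, 0)"
    and van: "p * (Q *\<^sub>v u) $ k + q * (Q *\<^sub>v w) $ k = 0"
  proof (cases "(Q *\<^sub>v w) $ k = 0")
    case True
    then show thesis using that[of 0 1] by simp
  next
    case False
    then show thesis using that[of "(Q *\<^sub>v w) $ k" "- (Q *\<^sub>v u) $ k"] by (simp add: mult.commute)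
  qed
  define x where "x = p \<cdot>\<^sub>v u + q \<cdot>\<^sub>v w"
  have x: "x \<in> carrier_vec N" unfolding x_def using u w by simp
  have "x \<noteq> 0\<^sub>v N" using indep pq unfolding x_def by auto
  then have pos: "x \<bullet> x > 0"
    using conjugate_square_greater_0_vec[OF x] x by (simp add: scalar_prod_def)
  have "Q *\<^sub>v x = p \<cdot>\<^sub>v (Q *\<^sub>v u) + q \<cdot>\<^sub>v (Q *\<^sub>v w)"
    unfolding x_def using Q u w by (simp add: mult_add_distrib_mat_vec mult_mat_vec)
  then have xk: "(Q *\<^sub>v x) $ k = 0"
    using van k Q by simp
  note coord = orthogonal_coordinates[OF Q QQ M x]
  show thesis
  proof (rule that[OF x_def pos])
    fix L assume "\<And>i. i < N \<Longrightarrow> i \<noteq> k \<Longrightarrow> d i \<le> L"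
    then show "x \<bullet> (M *\<^sub>v x) \<le> L * (x \<bullet> x)"
      unfolding coord using xk by (intro weighted_sum_le) auto
  next
    fix L assume "\<And>i. i < N \<Longrightarrow> i \<noteq> k \<Longrightarrow> L \<le> d i"
    then have "(\<Sum>i<N. - d i * ((Q *\<^sub>v x) $ i)\<^sup>2) \<le> - L * (\<Sum>i<N. ((Q *\<^sub>v x) $ i)\<^sup>2)"
      using xk by (intro weighted_sum_le) auto
    then show "L * (x \<bullet> x) \<le> x \<bullet> (M *\<^sub>v x)"
      unfolding coord by (simp add: sum_negf)
  qed
qed

text \<open>
  The case of planes in the Courant-Fischer theorem. The vector supplied by
  \<open>rayleigh_quotient_plane\<close> for the coordinate of the largest eigenvalue has Rayleigh quotient at
  most the second largest one; the coordinate of the smallest eigenvalue gives the other bound.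
\<close>

theorem eigenvalue_plane_bounds:
  fixes M :: "real mat"
  assumes M: "M \<in> carrier_mat N N" and sym: "transpose_mat M = M"
    and u: "u \<in> carrier_vec N" and w: "w \<in> carrier_vec N"
    and indep: "\<And>p q. p \<cdot>\<^sub>v u + q \<cdot>\<^sub>v w = 0\<^sub>v N \<Longrightarrow> p = 0 \<and> q = 0"
    and N: "2 \<le> N"
    and bounds: "\<And>p q x. x = p \<cdot>\<^sub>v u + q \<cdot>\<^sub>v w \<Longrightarrow>
      lo * (x \<bullet> x) \<le> x \<bullet> (M *\<^sub>v x) \<and> x \<bullet> (M *\<^sub>v x) \<le> hi * (x \<bullet> x)"
  shows "lo \<le> eigenvalue_list M ! 1" and "eigenvalue_list M ! (N - 2) \<le> hi"
proof -
  let ?l = "\<lambda>i. eigenvalue_list M ! i"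
  obtain Q where Q: "Q \<in> carrier_mat N N" "transpose_mat Q * Q = 1\<^sub>m N"
    "M = transpose_mat Q * mat_diag N ?l * Q"
    and len: "length (eigenvalue_list M) = N"
    using eigenvalue_list_diagonalizes[OF M sym] by blast
  have dec: "?l j \<le> ?l i" if "i \<le> j" "j < N" for i j
    using eigenvalue_list_decreasing that len by simp
  show "lo \<le> ?l 1"
  proof -
    obtain p q x where x: "x = p \<cdot>\<^sub>v u + q \<cdot>\<^sub>v w" and pos: "x \<bullet> x > 0"
      and le: "\<And>L. (\<And>i. i < N \<Longrightarrow> i \<noteq> 0 \<Longrightarrow> ?l i \<le> L) \<Longrightarrow> x \<bullet> (M *\<^sub>v x) \<le> L * (x \<bullet> x)"
      by (rule rayleigh_quotient_plane[OF Q u w indep, of 0]) (assumption | use N in linarith | blast)+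
    have "x \<bullet> (M *\<^sub>v x) \<le> ?l 1 * (x \<bullet> x)" by (rule le, rule dec) auto
    with bounds[OF x] have "lo * (x \<bullet> x) \<le> ?l 1 * (x \<bullet> x)" by linarith
    then show ?thesis using pos by simp
  qed
  show "?l (N - 2) \<le> hi"
  proof -
    obtain p q x where x: "x = p \<cdot>\<^sub>v u + q \<cdot>\<^sub>v w" and pos: "x \<bullet> x > 0"
      and ge: "\<And>L. (\<And>i. i < N \<Longrightarrow> i \<noteq> N - 1 \<Longrightarrow> L \<le> ?l i) \<Longrightarrow> L * (x \<bullet> x) \<le> x \<bullet> (M *\<^sub>v x)"
      by (rule rayleigh_quotient_plane[OF Q u w indep, of "N - 1"]) (assumption | use N in linarith | blast)+
    have "?l (N - 2) * (x \<bullet> x) \<le> x \<bullet> (M *\<^sub>v x)" by (rule ge, rule dec) (use N in auto)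
    with bounds[OF x] have "?l (N - 2) * (x \<bullet> x) \<le> hi * (x \<bullet> x)" by linarith
    then show ?thesis using pos by simp
  qed
qed

theorem rayleigh_quotient_bounds:
  fixes M :: "real mat"
  assumes M: "M \<in> carrier_mat N N" and sym: "transpose_mat M = M"
    and x: "x \<in> carrier_vec N" and N: "0 < N"
  shows "x \<bullet> (M *\<^sub>v x) \<le> eigenvalue_list M ! 0 * (x \<bullet> x)"
    and "eigenvalue_list M ! (N - 1) * (x \<bullet> x) \<le> x \<bullet> (M *\<^sub>v x)"
proof -
  let ?l = "\<lambda>i. eigenvalue_list M ! i"
  obtain Q where Q: "Q \<in> carrier_mat N N" "transpose_mat Q * Q = 1\<^sub>m N"
    "M = transpose_mat Q * mat_diag N ?l * Q"
    and len: "length (eigenvalue_list M) = N"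
    using eigenvalue_list_diagonalizes[OF M sym] by blast
  have dec: "?l j \<le> ?l i" if "i \<le> j" "j < N" for i j
    using eigenvalue_list_decreasing that len by simp
  note coord = orthogonal_coordinates[OF Q x]
  show "x \<bullet> (M *\<^sub>v x) \<le> ?l 0 * (x \<bullet> x)"
    unfolding coord by (rule weighted_sum_le[where k = 0]) (auto intro: dec)
  have "(\<Sum>i<N. - ?l i * ((Q *\<^sub>v x) $ i)\<^sup>2) \<le> - ?l (N - 1) * (\<Sum>i<N. ((Q *\<^sub>v x) $ i)\<^sup>2)"
    by (rule weighted_sum_le[where k = 0]) (use N in \<open>auto intro!: dec\<close>)
  then show "?l (N - 1) * (x \<bullet> x) \<le> x \<bullet> (M *\<^sub>v x)"
    unfolding coord by (simp add: sum_negf)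
qed


section \<open>Vectors that are constant on the two halves\<close>

definition entry_sum :: "real mat \<Rightarrow> real" where
  "entry_sum A = (\<Sum>i<dim_row A. \<Sum>j<dim_col A. A $$ (i, j))"

definition halves :: "nat \<Rightarrow> real \<Rightarrow> real \<Rightarrow> real vec" where
  "halves n p q = vec n (\<lambda>_. p) @\<^sub>v vec n (\<lambda>_. q)"

lemma halves_carrier [simp]: "halves n p q \<in> carrier_vec (2 * n)"
  unfolding halves_def by (simp add: mult_2)

lemma halves_combination:
  "p \<cdot>\<^sub>v halves n 1 0 + q \<cdot>\<^sub>v halves n 0 1 = halves n p q"
  unfolding halves_def by (intro eq_vecI) auto

lemma halves_eq_0: "n \<noteq> 0 \<Longrightarrow> halves n p q = 0\<^sub>v (2 * n) \<Longrightarrow> p = 0 \<and> q = 0"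
proof -
  assume n: "n \<noteq> 0" and eq: "halves n p q = 0\<^sub>v (2 * n)"
  from arg_cong[OF eq, of "\<lambda>x. x $ 0"] arg_cong[OF eq, of "\<lambda>x. x $ n"] n
  show ?thesis by (simp add: halves_def)
qed

lemma halves_scalar_prod: "halves n p q \<bullet> halves n p q = real n * (p\<^sup>2 + q\<^sup>2)"
  unfolding halves_def
  by (subst scalar_prod_append[of _ n _ n])
    (auto simp: scalar_prod_def power2_eq_square algebra_simps)

lemma constant_vec_bilinear_form:
  assumes "A \<in> carrier_mat n n"
  shows "vec n (\<lambda>_. p) \<bullet> (A *\<^sub>v vec n (\<lambda>_. q)) = p * q * entry_sum A"
  using assms
  by (auto simp: scalar_prod_def entry_sum_def sum_distrib_left atLeast0LessThan mult_ac
      intro!: sum.cong)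

lemma entry_sum_transpose: "entry_sum (transpose_mat A) = entry_sum A"
  unfolding entry_sum_def by (simp, rule sum.swap)

text \<open>
  Between constant vectors a block acts only through the sum of its entries, so \<open>M\<close> acts on this
  plane like the quotient matrix of the partition of its rows into two halves.
\<close>

lemma halves_quadratic_form:
  assumes A: "A \<in> carrier_mat n n" and D: "D \<in> carrier_mat n n"
  shows "halves n p q \<bullet> (four_block_mat A D (transpose_mat D) A *\<^sub>v halves n p q) =
    entry_sum A * (p\<^sup>2 + q\<^sup>2) + 2 * entry_sum D * p * q"
proof -
  let ?P = "vec n (\<lambda>_. p)" and ?Q = "vec n (\<lambda>_. q)"
  have DT: "transpose_mat D \<in> carrier_mat n n" using D by simp
  have PQ: "?P \<in> carrier_vec n" "?Q \<in> carrier_vec n" by auto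
  have "halves n p q \<bullet> (four_block_mat A D (transpose_mat D) A *\<^sub>v halves n p q) =
      ?P \<bullet> (A *\<^sub>v ?P + D *\<^sub>v ?Q) + ?Q \<bullet> (transpose_mat D *\<^sub>v ?P + A *\<^sub>v ?Q)"
    unfolding halves_def four_block_mat_mult_vec[OF A D DT A PQ]
    by (rule scalar_prod_append[of _ n _ n]) (use A D in auto)
  also have "\<dots> = ?P \<bullet> (A *\<^sub>v ?P) + ?P \<bullet> (D *\<^sub>v ?Q) +
      (?Q \<bullet> (transpose_mat D *\<^sub>v ?P) + ?Q \<bullet> (A *\<^sub>v ?Q))"
    using A D by (simp add: scalar_prod_add_distrib[of _ n])
  finally show ?thesis
    unfolding constant_vec_bilinear_form[OF A] constant_vec_bilinear_form[OF D]
      constant_vec_bilinear_form[OF DT] entry_sum_transpose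
    by (simp add: power2_eq_square algebra_simps)
qed

section \<open>Counting edges and arcs\<close>

lemma (in mixed_graph) entry_sum_arc_mat:
  assumes n: "card (verts G) = n" and v: "bij_betw v {..<n} (verts G)"
  shows "entry_sum (arc_mat G v) = real (num_arcs G)"
proof -
  let ?S = "{..<n} \<times> {..<n}"
  let ?h = "\<lambda>(i, j). {a \<in> arcs G. tail G a = v i \<and> head G a = v j}"
  have "entry_sum (arc_mat G v) = real (\<Sum>x\<in>?S. card (?h x))"
    by (simp add: entry_sum_def arc_mat_def n sum.cartesian_product case_prod_beta)
  also have "(\<Sum>x\<in>?S. card (?h x)) = card (\<Union>x\<in>?S. ?h x)"
  proof (rule card_UN_disjoint[symmetric])
    show "\<forall>x\<in>?S. finite (?h x)" using finite_arcs by auto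
    show "\<forall>x\<in>?S. \<forall>y\<in>?S. x \<noteq> y \<longrightarrow> ?h x \<inter> ?h y = {}"
      using bij_betw_imp_inj_on[OF v] by (auto simp: inj_on_def)
  qed simp
  also have "(\<Union>x\<in>?S. ?h x) = arcs G"
  proof -
    have "\<exists>i<n. \<exists>j<n. tail G a = v i \<and> head G a = v j" if "a \<in> arcs G" for a
      using tail_in_verts[OF that] head_in_verts[OF that] bij_betw_imp_surj_on[OF v] by blast
    then show ?thesis by fastforce
  qed
  finally show ?thesis by (simp add: num_arcs_def)
qed

text \<open>
  Every edge contributes exactly 2: a proper edge contributes 1 to each of two symmetric entries, and
  a loop contributes 2 to a single diagonal entry. This is what the doubling on the diagonal is for.
\<close>

lemma (in mixed_graph) entry_sum_edge_mat:
  assumes n: "card (verts G) = n" and v: "bij_betw v {..<n} (verts G)"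
  shows "entry_sum (edge_mat G v) = 2 * real (num_edges G) + 2 * real (num_loops G)"
proof -
  let ?S = "{..<n} \<times> {..<n}"
  let ?c = "\<lambda>e (i, j). if ends G e = Upair (v i) (v j) then if i = j then 2 else 1 else 0 :: real"
  have inj: "v i = v j \<longleftrightarrow> i = j" if "i < n" "j < n" for i j
    using bij_betw_imp_inj_on[OF v] that by (auto simp: inj_on_def)
  have entry: "edge_mat G v $$ (i, j) = (\<Sum>e\<in>edges G. ?c e (i, j))" if "i < n" "j < n" for i j
    using that finite_edges by (simp add: edge_mat_def n flip: sum.inter_filter)
  have "dim_row (edge_mat G v) = n" "dim_col (edge_mat G v) = n"
    by (simp_all add: edge_mat_def n)
  then have "entry_sum (edge_mat G v) = (\<Sum>(i, j)\<in>?S. edge_mat G v $$ (i, j))"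
    unfolding entry_sum_def by (simp add: sum.cartesian_product)
  also have "\<dots> = (\<Sum>x\<in>?S. \<Sum>e\<in>edges G. ?c e x)"
    by (intro sum.cong) (auto simp: entry)
  also have "\<dots> = (\<Sum>e\<in>edges G. \<Sum>x\<in>?S. ?c e x)" by (rule sum.swap)
  also have "\<dots> = (\<Sum>e\<in>edges G. 2)"
  proof (rule sum.cong[OF refl])
    fix e assume e: "e \<in> edges G"
    obtain a b where ab: "ends G e = Upair a b" by (cases "ends G e")
    then have "a \<in> verts G" "b \<in> verts G" using ends_in_verts[OF e] by auto
    then obtain k l where k: "k < n" "a = v k" and l: "l < n" "b = v l"
      using bij_betw_imp_surj_on[OF v] by (metis imageE lessThan_iff)
    have "(\<Sum>x\<in>?S. ?c e x) = (\<Sum>x\<in>{(k, l), (l, k)}. ?c e x)"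
      using k l by (intro sum.mono_neutral_right) (auto simp: ab inj split: if_splits)
    also have "\<dots> = 2" using k l by (cases "k = l") (auto simp: ab inj)
    finally show "(\<Sum>x\<in>?S. ?c e x) = 2" .
  qed
  also have "\<dots> = 2 * real (card (edges G))" by simp
  also have "card (edges G) = num_edges G + num_loops G"
    unfolding num_edges_def num_loops_def
    by (subst card_Un_disjoint[symmetric]) (use finite_edges in \<open>auto intro!: arg_cong[of _ _ card]\<close>)
  finally show ?thesis by simp
qed

section \<open>Bounds for the eigenvalues of the integrated adjacency matrix\<close>

theorem theorem8p4:
  fixes G :: "('v, 'e, 'a) mixed_graph" and v :: "nat \<Rightarrow> 'v" and n :: nat
  assumes "mixed_graph G"
    and "card (verts G) = n"
    and "bij_betw v {..<n} (verts G)"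
  shows "I_eigenvalue G v (2 * n - 1)
           \<le> 1 / real n * (2 * real (num_edges G) + 2 * real (num_loops G) + real (num_arcs G))
       \<and> 1 / real n * (2 * real (num_edges G) + 2 * real (num_loops G) + real (num_arcs G))
           \<le> I_eigenvalue G v 1
       \<and> I_eigenvalue G v (2 * n)
           \<le> 1 / real n * (2 * real (num_edges G) + 2 * real (num_loops G) - real (num_arcs G))
       \<and> 1 / real n * (2 * real (num_edges G) + 2 * real (num_loops G) - real (num_arcs G))
           \<le> I_eigenvalue G v 2"
proof -
  interpret mixed_graph G by fact
  let ?A = "edge_mat G v" and ?D = "arc_mat G v" and ?M = "integrated_adjacency_mat G v"
  define s where "s = 2 * real (num_edges G) + 2 * real (num_loops G)"
  define a where "a = real (num_arcs G)"
  let ?N = "2 * n"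
  have n: "n \<noteq> 0" using assms(2) finite_verts verts_nonempty by auto
  have A: "?A \<in> carrier_mat n n" and D: "?D \<in> carrier_mat n n"
    unfolding edge_mat_def arc_mat_def assms(2) by auto
  have AT: "transpose_mat ?A = ?A"
    by (intro eq_matI) (auto simp: edge_mat_def intro!: arg_cong[of _ _ card])
  have M: "?M \<in> carrier_mat ?N ?N"
    unfolding integrated_adjacency_mat_def mult_2 using A D by auto
  have MT: "transpose_mat ?M = ?M"
    unfolding integrated_adjacency_mat_def using A D
    by (subst transpose_four_block_mat) (auto simp: AT)
  have form: "halves n p q \<bullet> (?M *\<^sub>v halves n p q) = s * (p\<^sup>2 + q\<^sup>2) + 2 * a * p * q" for p q
    unfolding integrated_adjacency_mat_def halves_quadratic_form[OF A D] s_def a_def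
      entry_sum_edge_mat[OF assms(2,3)] entry_sum_arc_mat[OF assms(2,3)] ..
  have bounds: "(s - a) / n * (x \<bullet> x) \<le> x \<bullet> (?M *\<^sub>v x) \<and> x \<bullet> (?M *\<^sub>v x) \<le> (s + a) / n * (x \<bullet> x)"
    if x: "x = p \<cdot>\<^sub>v halves n 1 0 + q \<cdot>\<^sub>v halves n 0 1" for p q x
  proof -
    \<comment> \<open>These are the differences between the quadratic form and its two bounds.\<close>
    have "0 \<le> a * (p + q)\<^sup>2" "0 \<le> a * (p - q)\<^sup>2" unfolding a_def by auto
    then have "(s - a) * (p\<^sup>2 + q\<^sup>2) \<le> s * (p\<^sup>2 + q\<^sup>2) + 2 * a * p * q"
      "s * (p\<^sup>2 + q\<^sup>2) + 2 * a * p * q \<le> (s + a) * (p\<^sup>2 + q\<^sup>2)"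
      by (auto simp: power2_eq_square algebra_simps)
    then show ?thesis
      unfolding x halves_combination form halves_scalar_prod using n by simp
  qed
  have indep: "p = 0 \<and> q = 0" if "p \<cdot>\<^sub>v halves n 1 0 + q \<cdot>\<^sub>v halves n 0 1 = 0\<^sub>v ?N" for p q
    using that n halves_eq_0 unfolding halves_combination by blast
  have "2 \<le> ?N" using n by simp
  note plane = eigenvalue_plane_bounds[OF M MT halves_carrier halves_carrier indep this bounds]
  have "0 < ?N" using n by simp
  note line = rayleigh_quotient_bounds[OF M MT halves_carrier this, unfolded form halves_scalar_prod]
  have "(s + a) / n \<le> eigenvalue_list ?M ! 0"
    using line(1)[of 1 1] n by (simp add: field_simps)
  moreover have "eigenvalue_list ?M ! (?N - 1) \<le> (s - a) / n"
    using line(2)[of 1 "- 1"] n by (simp add: field_simps)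
  ultimately show ?thesis
    using plane unfolding I_eigenvalue_def s_def a_def
    by (simp add: numeral_2_eq_2 diff_diff_eq)
qed

end
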